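(* Let $0<\theta\leq1$, let $f\in L^1(\mathbb{R})$, $g\in L^2(\mathbb{R})$ and let $\psi$ be a fractional wavelet. Then for all $a\in\mathbb{R}\setminus\{0\}$ and $b\in\mathbb{R}$, $$\left(W_\psi^\theta(f\star g)\right)(b,a)=\left(f(\cdot)\star(W_\psi^\theta g)(\cdot,a)\right)(b)$$ and $$\left(W_\psi^\theta(f\circ g)\right)(b,a)=\left(f(\cdot)\circ(W_\psi^\theta g)(\cdot,a)\right)(b).$$
   Context: Functions are complex-valued on $\mathbb{R}$. Convolution: $(f\star g)(x)=\int_{\mathbb{R}}f(u)g(x-u)\,du$. Correlation: $(f\circ g)(x)=\int_{\mathbb{R}}\overline{f(u)}g(x+u)\,du$ (whenever the integrals are well-defined). For $0<\theta\leq1$, the fractional Fourier transform is $(\mathfrak{F}_\theta f)(\xi)=\int_{\mathbb{R}}e^{-i(\operatorname{sgn}\xi)|\xi|^{1/\theta}t}f(t)\,dt$. A fractional wavelet (of order $\theta$) is a non-zero function $\psi\in L^1(\mathbb{R})\cap L^2(\mathbb{R})$ with $\int_{\mathbb{R}}\frac{|(\mathfrak{F}_\theta\psi)(\xi)|^2}{|\xi|}\,d\xi<\infty$. For $a\in\mathbb{R}\setminus\{0\}$, $b\in\mathbb{R}$, put $\psi_{a,b,\theta}(t)=\frac{1}{|a|^{1/(2\theta)}}\psi\left(\frac{t-b}{(\operatorname{sgn} a)|a|^{1/\theta}}\right)$. The continuous fractional wavelet transform (CFrWT) of $g$ with respect to $\psi$ is $(W_\psi^\theta g)(b,a)=\int_{\mathbb{R}}g(t)\overline{\psi_{a,b,\theta}(t)}\,dt$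 whenever the integral is well-defined. In the claim the convolution and correlation on the right-hand sides are taken in the variable $b$ with $a$ fixed. *)

theory Defs
  imports "HOL-Analysis.Analysis"
begin

text \<open>
  Elements of \<open>L\<^sup>1\<close> and \<open>L\<^sup>2\<close> are represented by Lebesgue measurable functions, and all
  integrals are Lebesgue integrals. The Bochner integral of a non-integrable function is \<open>0\<close>,
  so the clause ``whenever the integral is well-defined'' is recorded by the separate predicates
  \<open>conv_exists\<close>, \<open>corr_exists\<close> and \<open>cfrwt_exists\<close>.
\<close>

definition L1 :: "(real \<Rightarrow> complex) set" where
  "L1 = {f. integrable lebesgue f}"

definition L2 :: "(real \<Rightarrow> complex) set" where
  "L2 = {f. f \<in> borel_measurable lebesgue \<and> integrable lebesgue (\<lambda>x. (cmod (f x))\<^sup>2)}"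

definition conv :: "(real \<Rightarrow> complex) \<Rightarrow> (real \<Rightarrow> complex) \<Rightarrow> real \<Rightarrow> complex" where
  "conv f g x = (\<integral>u. f u * g (x - u) \<partial>lebesgue)"

definition conv_exists :: "(real \<Rightarrow> complex) \<Rightarrow> (real \<Rightarrow> complex) \<Rightarrow> real \<Rightarrow> bool" where
  "conv_exists f g x \<longleftrightarrow> integrable lebesgue (\<lambda>u. f u * g (x - u))"

definition corr :: "(real \<Rightarrow> complex) \<Rightarrow> (real \<Rightarrow> complex) \<Rightarrow> real \<Rightarrow> complex" where
  "corr f g x = (\<integral>u. cnj (f u) * g (x + u) \<partial>lebesgue)"

definition corr_exists :: "(real \<Rightarrow> complex) \<Rightarrow> (real \<Rightarrow> complex) \<Rightarrow> real \<Rightarrow> bool" where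
  "corr_exists f g x \<longleftrightarrow> integrable lebesgue (\<lambda>u. cnj (f u) * g (x + u))"

definition frac_fourier :: "real \<Rightarrow> (real \<Rightarrow> complex) \<Rightarrow> real \<Rightarrow> complex" where
  "frac_fourier \<theta> f \<xi> =
     (\<integral>t. exp (- \<i> * complex_of_real (sgn \<xi> * \<bar>\<xi>\<bar> powr (1 / \<theta>) * t)) * f t \<partial>lebesgue)"

text \<open>
  ``Non-zero'' means non-zero as an element of \<open>L\<^sup>1 \<inter> L\<^sup>2\<close>, that is, not almost everywhere zero.
  The integrand of the admissibility integral takes the value \<open>0\<close> at \<open>\<xi> = 0\<close>
  (division by zero), which affects only a null set.
\<close>

definition fractional_wavelet :: "real \<Rightarrow> (real \<Rightarrow> complex) \<Rightarrow> bool" where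
  "fractional_wavelet \<theta> \<psi> \<longleftrightarrow>
     \<psi> \<in> L1 \<inter> L2 \<and>
     \<not> (AE t in lebesgue. \<psi> t = 0) \<and>
     (\<integral>\<^sup>+ \<xi>. ennreal ((cmod (frac_fourier \<theta> \<psi> \<xi>))\<^sup>2 / \<bar>\<xi>\<bar>) \<partial>lebesgue) < \<infinity>"

definition wavelet_atom :: "real \<Rightarrow> (real \<Rightarrow> complex) \<Rightarrow> real \<Rightarrow> real \<Rightarrow> real \<Rightarrow> complex" where
  "wavelet_atom \<theta> \<psi> a b t =
     complex_of_real (1 / \<bar>a\<bar> powr (1 / (2 * \<theta>))) * \<psi> ((t - b) / (sgn a * \<bar>a\<bar> powr (1 / \<theta>)))"

definition cfrwt ::
    "real \<Rightarrow> (real \<Rightarrow> complex) \<Rightarrow> (real \<Rightarrow> complex) \<Rightarrow> real \<Rightarrow> real \<Rightarrow> complex" where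
  "cfrwt \<theta> \<psi> g b a = (\<integral>t. g t * cnj (wavelet_atom \<theta> \<psi> a b t) \<partial>lebesgue)"

definition cfrwt_exists ::
    "real \<Rightarrow> (real \<Rightarrow> complex) \<Rightarrow> (real \<Rightarrow> complex) \<Rightarrow> real \<Rightarrow> real \<Rightarrow> bool" where
  "cfrwt_exists \<theta> \<psi> g b a \<longleftrightarrow> integrable lebesgue (\<lambda>t. g t * cnj (wavelet_atom \<theta> \<psi> a b t))"

end

theory Submission
  imports Defs
begin

text \<open>
  For fixed scale the wavelet transform is \<open>S b = \<integral>t. g t * cnj (\<phi> (t - b))\<close> with \<open>\<phi> \<in> L\<^sup>2\<close>.
  The function \<open>(u, t) \<mapsto> f u * g (t - u) * cnj (\<phi> (t - b))\<close> is integrable on the plane, being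
  dominated by \<open>\<bar>f u\<bar> * (\<bar>g (t - u)\<bar>\<^sup>2 + \<bar>\<phi> (t - b)\<bar>\<^sup>2)\<close>, and its two iterated integrals are the
  two sides of the convolution identity. The same domination with \<open>1\<close> in place of \<open>\<phi>\<close> shows that
  the convolution exists almost everywhere. A correlation with \<open>f\<close> is a convolution with
  \<open>u \<mapsto> cnj (f (- u))\<close>. As a Lebesgue measurable function need not give a function
  \<open>(u, t) \<mapsto> g (t - u)\<close> that is measurable for the product \<open>\<sigma>\<close>-algebra, Fubini's theorem is
  applied to Borel representatives.
\<close>

section \<open>Borel representatives\<close>

lemma borel_representative_complex:
  fixes f :: "'a::euclidean_space \<Rightarrow> complex"
  assumes "f \<in> borel_measurable lebesgue"
  obtains f' where "f' \<in> borel_measurable borel" "AE x in lborel. f x = f' x"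
proof -
  have "(\<lambda>x. Re (f x)) \<in> borel_measurable lebesgue" "(\<lambda>x. Im (f x)) \<in> borel_measurable lebesgue"
    using assms by simp_all
  then obtain p q
    where pq: "p \<in> borel_measurable lborel" "AE x in lborel. Re (f x) = p x"
      "q \<in> borel_measurable lborel" "AE x in lborel. Im (f x) = q x"
    by (metis completion_ex_borel_measurable_real)
  show thesis
  proof
    show "(\<lambda>x. Complex (p x) (q x)) \<in> borel_measurable borel"
      using pq(1,3) by (simp add: borel_measurable_complex_iff)
    show "AE x in lborel. f x = Complex (p x) (q x)"
      using pq(2,4) by eventually_elim (simp add: complex_eq_iff)
  qed
qed

text \<open>Lebesgue measure is complete: preimages of a Borel set under \<open>f\<close> and
  \<open>g\<close> differ by a null set, so one is measurable once the other is.\<close>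

lemma borel_measurable_lebesgue_cong_AE:
  assumes g: "g \<in> borel_measurable borel" and eq: "AE x in lborel. f x = g x"
  shows "f \<in> borel_measurable lebesgue"
proof (rule measurableI)
  fix A :: "'b set" assume "A \<in> sets borel"
  then have "{x \<in> space lebesgue. g x \<in> A} \<in> sets lebesgue"
    using measurable_sets[OF measurable_completion[of g lborel borel]] g
    by (simp add: vimage_def)
  then have "{x \<in> space lebesgue. f x \<in> A} \<in> sets lebesgue"
  proof (rule completion.in_sets_AE[rotated])
    show "AE x in lebesgue. (x \<in> {x \<in> space lebesgue. g x \<in> A}) = (x \<in> {x \<in> space lebesgue. f x \<in> A})"
      using AE_completion[OF eq] by eventually_elim simp
  qed simp
  then show "f -` A \<inter> space lebesgue \<in> sets lebesgue"
    by (simp add: vimage_def)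
qed simp

text \<open>The bridge from \<open>lebesgue\<close> to \<open>lborel\<close>: a Borel representative
  has the same integral and the same integrability, so Fubini's theorem can be applied to Borel
  functions and the result carried back.\<close>

lemma
  fixes f g :: "'a::euclidean_space \<Rightarrow> 'b::{banach, second_countable_topology}"
  assumes g: "g \<in> borel_measurable borel" and eq: "AE x in lborel. f x = g x"
  shows integrable_lebesgue_cong_AE: "integrable lebesgue f \<longleftrightarrow> integrable lborel g"
    and integral_lebesgue_cong_AE: "integral\<^sup>L lebesgue f = integral\<^sup>L lborel g"
proof -
  have f': "f \<in> borel_measurable lebesgue"
    by (rule borel_measurable_lebesgue_cong_AE[OF g eq])
  have g': "g \<in> borel_measurable lebesgue"
    using g by (simp add: measurable_completion)
  show "integrable lebesgue f \<longleftrightarrow> integrable lborel g"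
    using integrable_cong_AE[OF f' g' AE_completion[OF eq]] g
    by (simp add: integrable_completion)
  show "integral\<^sup>L lebesgue f = integral\<^sup>L lborel g"
    using integral_cong_AE[OF f' g' AE_completion[OF eq]] g
    by (simp add: integral_completion)
qed

text \<open>Affine maps of nonzero slope pull null sets back to null sets. As \<open>P\<close> need
  not be measurable, its exceptional set is first enlarged to a Borel null set
  \<open>N\<close>.\<close>

lemma AE_lborel_real_affine:
  fixes P :: "real \<Rightarrow> bool"
  assumes "c \<noteq> 0" and "AE x in lborel. P x"
  shows "AE x in lborel. P (t + c * x)"
proof -
  obtain N where N: "N \<in> null_sets lborel" "{x. \<not> P x} \<subseteq> N"
    using assms(2) by (auto simp: eventually_ae_filter)
  then have "AE x in lborel. x \<notin> N" "Measurable.pred borel (\<lambda>x. x \<notin> N)"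
    by (auto simp: AE_not_in null_sets_def)
  then have "AE x in lborel. t + c * x \<notin> N"
    using AE_borel_affine[OF assms(1), of "\<lambda>x. x \<notin> N"] by simp
  then show ?thesis
    by eventually_elim (use N in auto)
qed

section \<open>The convolution identity for Borel functions\<close>

lemma measurable_cnj [measurable]: "cnj \<in> borel_measurable borel"
  by (intro borel_measurable_continuous_onI continuous_intros)

lemma integrable_mult_shift:
  fixes f h :: "real \<Rightarrow> real"
  assumes f: "integrable lborel f" and h: "integrable lborel h"
    and [measurable]: "k \<in> borel_measurable borel"
  shows "integrable (lborel \<Otimes>\<^sub>M lborel) (\<lambda>(u, t). f u * h (t - k u))"
proof (rule lborel_pair.Fubini_integrable)
  have [measurable]: "f \<in> borel_measurable borel" "h \<in> borel_measurable borel"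
    using f h by auto
  show "(\<lambda>(u, t). f u * h (t - k u)) \<in> borel_measurable (lborel \<Otimes>\<^sub>M lborel)"
    by measurable
  have "(\<integral>t. \<bar>h (t - v)\<bar> \<partial>lborel) = (\<integral>t. \<bar>h t\<bar> \<partial>lborel)" for v
    using lborel_integral_real_affine[of 1 "\<lambda>t. \<bar>h t\<bar>" "- v"] by simp
  then have "(\<lambda>u. \<integral>t. norm (f u * h (t - k u)) \<partial>lborel) = (\<lambda>u. \<bar>f u\<bar> * (\<integral>t. \<bar>h t\<bar> \<partial>lborel))"
    by (simp add: abs_mult)
  then show "integrable lborel (\<lambda>u. \<integral>t. norm (case (u, t) of (u, t) \<Rightarrow> f u * h (t - k u)) \<partial>lborel)"
    using f by simp
  have "integrable lborel (\<lambda>t. h (t - v))" for v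
    using lborel_integrable_real_affine[OF h, of 1 "- v"] by simp
  then show "AE u in lborel. integrable lborel (\<lambda>t. case (u, t) of (u, t) \<Rightarrow> f u * h (t - k u))"
    by simp
qed

text \<open>From \<open>2 * x * y\<close> \<le> \<open>x\<^sup>2 + y\<^sup>2\<close>; nonnegativity
  allows the factor 2 to be dropped. It plays the part of the Cauchy-Schwarz inequality, with a sum
  as majorant whose terms can be integrated separately.\<close>

lemma mult_le_sum_squares:
  fixes x y :: real
  assumes "0 \<le> x" "0 \<le> y"
  shows "x * y \<le> x\<^sup>2 + y\<^sup>2"
  using sum_squares_bound[of x y] assms mult_nonneg_nonneg[OF assms] by linarith

lemma
  fixes f g \<phi> :: "real \<Rightarrow> complex"
  assumes f: "integrable lborel f"
    and [measurable]: "g \<in> borel_measurable borel" and g: "integrable lborel (\<lambda>x. (cmod (g x))\<^sup>2)"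
  shows AE_integrable_conv_lborel: "AE x in lborel. integrable lborel (\<lambda>u. f u * g (x - u))"
    and integrable_conv_kernel_lborel:
      "\<lbrakk>\<phi> \<in> borel_measurable borel; integrable lborel (\<lambda>x. (cmod (\<phi> x))\<^sup>2)\<rbrakk> \<Longrightarrow>
        integrable (lborel \<Otimes>\<^sub>M lborel) (\<lambda>(u, t). f u * g (t - u) * cnj (\<phi> (t - b)))"
proof -
  have [measurable]: "f \<in> borel_measurable borel"
    using f by auto
  have nf: "integrable lborel (\<lambda>u. cmod (f u))"
    using f by simp
  have fg: "integrable (lborel \<Otimes>\<^sub>M lborel) (\<lambda>(u, t). cmod (f u) * (cmod (g (t - u)))\<^sup>2)"
    using integrable_mult_shift[OF nf g, of "\<lambda>u. u"] by simp
  show "AE x in lborel. integrable lborel (\<lambda>u. f u * g (x - u))"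
    \<comment> \<open>Almost every section in \<open>u\<close> of the integrable majorant is
      integrable; adding \<open>cmod (f u)\<close> then dominates the convolution integrand.\<close>
    using lborel_pair.AE_integrable_snd[OF fg]
  proof eventually_elim
    case (elim x)
    with nf have "integrable lborel (\<lambda>u. cmod (f u) * (cmod (g (x - u)))\<^sup>2 + cmod (f u))"
      by simp
    then show ?case
    proof (rule Bochner_Integration.integrable_bound)
      have "cmod (f u) * cmod (g (x - u)) \<le> cmod (f u) * ((cmod (g (x - u)))\<^sup>2 + 1)" for u
        using mult_le_sum_squares[of "cmod (g (x - u))" 1] by (intro mult_left_mono) auto
      then show "AE u in lborel. norm (f u * g (x - u))
          \<le> norm (cmod (f u) * (cmod (g (x - u)))\<^sup>2 + cmod (f u))"
        by (simp add: norm_mult distrib_left)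
    qed measurable
  qed
  assume [measurable]: "\<phi> \<in> borel_measurable borel"
    and \<phi>: "integrable lborel (\<lambda>x. (cmod (\<phi> x))\<^sup>2)"
  have "integrable (lborel \<Otimes>\<^sub>M lborel) (\<lambda>(u, t). cmod (f u) * (cmod (\<phi> (t - b)))\<^sup>2)"
    using integrable_mult_shift[OF nf \<phi>, of "\<lambda>u. b"] by simp
  from Bochner_Integration.integrable_add[OF fg this]
  show "integrable (lborel \<Otimes>\<^sub>M lborel) (\<lambda>(u, t). f u * g (t - u) * cnj (\<phi> (t - b)))"
  proof (rule Bochner_Integration.integrable_bound)
    have "cmod (f u) * (cmod (g (t - u)) * cmod (\<phi> (t - b)))
        \<le> cmod (f u) * ((cmod (g (t - u)))\<^sup>2 + (cmod (\<phi> (t - b)))\<^sup>2)" for u t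
      by (intro mult_left_mono mult_le_sum_squares) auto
    then show "AE x in lborel \<Otimes>\<^sub>M lborel. norm (case x of (u, t) \<Rightarrow> f u * g (t - u) * cnj (\<phi> (t - b)))
        \<le> norm ((case x of (u, t) \<Rightarrow> cmod (f u) * (cmod (g (t - u)))\<^sup>2)
            + (case x of (u, t) \<Rightarrow> cmod (f u) * (cmod (\<phi> (t - b)))\<^sup>2))"
      by (auto simp: norm_mult distrib_left mult.assoc)
  qed measurable
qed

lemma integrable_mult_L2_lborel:
  fixes g \<phi> :: "real \<Rightarrow> complex"
  assumes [measurable]: "g \<in> borel_measurable borel" "\<phi> \<in> borel_measurable borel"
    and g: "integrable lborel (\<lambda>x. (cmod (g x))\<^sup>2)" and \<phi>: "integrable lborel (\<lambda>x. (cmod (\<phi> x))\<^sup>2)"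
  shows "integrable lborel (\<lambda>t. g t * cnj (\<phi> (t - b)))"
proof -
  have "integrable lborel (\<lambda>t. (cmod (\<phi> (t - b)))\<^sup>2)"
    using lborel_integrable_real_affine[OF \<phi>, of 1 "- b"] by simp
  from Bochner_Integration.integrable_add[OF g this] show ?thesis
    by (rule Bochner_Integration.integrable_bound)
      (measurable, auto simp: norm_mult intro!: mult_le_sum_squares)
qed

text \<open>Fubini's theorem for the kernel \<open>?K\<close>: integrating out \<open>u\<close>
  first gives the transform of the convolution, integrating out \<open>t\<close> first gives the
  convolution with the transform.\<close>

lemma
  fixes f g \<phi> :: "real \<Rightarrow> complex" and b :: real
  assumes f: "integrable lborel f"
    and g: "g \<in> borel_measurable borel" "integrable lborel (\<lambda>x. (cmod (g x))\<^sup>2)"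
    and \<phi>: "\<phi> \<in> borel_measurable borel" "integrable lborel (\<lambda>x. (cmod (\<phi> x))\<^sup>2)"
  defines "C \<equiv> \<lambda>t. \<integral>u. f u * g (t - u) \<partial>lborel"
    and "S \<equiv> \<lambda>b. \<integral>t. g t * cnj (\<phi> (t - b)) \<partial>lborel"
  shows integrable_transform_conv_lborel: "integrable lborel (\<lambda>t. C t * cnj (\<phi> (t - b)))"
    and integrable_conv_transform_lborel: "integrable lborel (\<lambda>u. f u * S (b - u))"
    and transform_conv_lborel:
      "(\<integral>t. C t * cnj (\<phi> (t - b)) \<partial>lborel) = (\<integral>u. f u * S (b - u) \<partial>lborel)"
proof -
  let ?K = "\<lambda>u t. f u * g (t - u) * cnj (\<phi> (t - b))"
  have K: "integrable (lborel \<Otimes>\<^sub>M lborel) (case_prod ?K)"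
    by (rule integrable_conv_kernel_lborel[OF f g \<phi>])
  \<comment> \<open>This holds for every \<open>t\<close>: where the convolution integral diverges,
    \<open>C t\<close> is the default 0, and the left side is 0 as well, whether or not the factor
    from \<phi> vanishes.\<close>
  have C: "(\<integral>u. ?K u t \<partial>lborel) = C t * cnj (\<phi> (t - b))" for t
    by (simp add: C_def)
  \<comment> \<open>Translating \<open>t\<close> by \<open>u\<close> removes the shift from
    \<open>g\<close> and moves it to the parameter of \<open>S\<close>, turning \<open>b\<close>
    into \<open>b - u\<close>.\<close>
  have S: "(\<integral>t. ?K u t \<partial>lborel) = f u * S (b - u)" for u
    using lborel_integral_real_affine[of 1 "\<lambda>t. g t * cnj (\<phi> (t - (b - u)))" "- u"]
    by (simp add: S_def mult.assoc)
  show "integrable lborel (\<lambda>t. C t * cnj (\<phi> (t - b)))"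
    using lborel_pair.integrable_snd[OF K] by (simp only: C)
  show "integrable lborel (\<lambda>u. f u * S (b - u))"
    using lborel_pair.integrable_fst[OF K] by (simp only: S)
  show "(\<integral>t. C t * cnj (\<phi> (t - b)) \<partial>lborel) = (\<integral>u. f u * S (b - u) \<partial>lborel)"
    using lborel_pair.Fubini_integral[OF K] by (simp only: C S)
qed

section \<open>Lebesgue measurable functions\<close>

lemma L1_borel_representative:
  assumes "f \<in> L1"
  obtains f' where "integrable lborel f'" "AE x in lborel. f x = f' x"
  using borel_representative_complex[of f] integrable_lebesgue_cong_AE[of _ f] assms
  by (metis L1_def borel_measurable_integrable mem_Collect_eq)

lemma L2_borel_representative:
  assumes "g \<in> L2"
  obtains g' where "g' \<in> borel_measurable borel" "integrable lborel (\<lambda>x. (cmod (g' x))\<^sup>2)"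
    "AE x in lborel. g x = g' x"
proof -
  obtain g' where g': "g' \<in> borel_measurable borel" "AE x in lborel. g x = g' x"
    using borel_representative_complex assms by (auto simp: L2_def)
  have "AE x in lborel. (cmod (g x))\<^sup>2 = (cmod (g' x))\<^sup>2"
    using g'(2) by eventually_elim simp
  then have "integrable lborel (\<lambda>x. (cmod (g' x))\<^sup>2)"
    using integrable_lebesgue_cong_AE[of "\<lambda>x. (cmod (g' x))\<^sup>2"] g'(1) assms by (simp add: L2_def)
  with g' that show thesis
    by blast
qed

lemma
  fixes f g \<phi> :: "real \<Rightarrow> complex" and b :: real
  assumes "f \<in> L1" "g \<in> L2" "\<phi> \<in> L2"
  defines "S \<equiv> \<lambda>b. \<integral>t. g t * cnj (\<phi> (t - b)) \<partial>lebesgue"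
  shows AE_conv_exists: "AE x in lebesgue. conv_exists f g x"
    and integrable_mult_L2: "integrable lebesgue (\<lambda>t. g t * cnj (\<phi> (t - b)))"
    and integrable_transform_conv: "integrable lebesgue (\<lambda>t. conv f g t * cnj (\<phi> (t - b)))"
    and conv_exists_transform: "conv_exists f S b"
    and transform_conv: "(\<integral>t. conv f g t * cnj (\<phi> (t - b)) \<partial>lebesgue) = conv f S b"
proof -
  obtain f' where f': "integrable lborel f'" and ff': "AE x in lborel. f x = f' x"
    using L1_borel_representative[OF assms(1)] .
  obtain g' where g': "g' \<in> borel_measurable borel" "integrable lborel (\<lambda>x. (cmod (g' x))\<^sup>2)"
    and gg': "AE x in lborel. g x = g' x"
    using L2_borel_representative[OF assms(2)] .
  obtain \<phi>' where \<phi>': "\<phi>' \<in> borel_measurable borel" "integrable lborel (\<lambda>x. (cmod (\<phi>' x))\<^sup>2)"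
    and \<phi>\<phi>': "AE x in lborel. \<phi> x = \<phi>' x"
    using L2_borel_representative[OF assms(3)] .
  note [measurable] = g'(1) \<phi>'(1) borel_measurable_integrable[OF f', simplified]
  have g_shift: "AE u in lborel. g (x - u) = g' (x - u)" for x
    using AE_lborel_real_affine[OF _ gg', of "-1" x] by simp
  have \<phi>_shift: "AE t in lborel. \<phi> (t - b) = \<phi>' (t - b)" for b
    using AE_lborel_real_affine[OF _ \<phi>\<phi>', of 1 "- b"] by simp
  have conv_integrand: "AE u in lborel. f u * g (x - u) = f' u * g' (x - u)" for x
    using ff' g_shift[of x] by eventually_elim simp
  have transform_integrand: "AE t in lborel. g t * cnj (\<phi> (t - b)) = g' t * cnj (\<phi>' (t - b))" for b
    using gg' \<phi>_shift[of b] by eventually_elim simp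
  \<comment> \<open>Equality at every point, not just almost everywhere: for each fixed
    \<open>x\<close>, passing to representatives changes the integrand only on a null set of
    \<open>u\<close>. The same holds for \<open>S\<close> below.\<close>
  have conv_eq: "conv f g = (\<lambda>x. \<integral>u. f' u * g' (x - u) \<partial>lborel)"
    unfolding conv_def by (rule ext, rule integral_lebesgue_cong_AE[OF _ conv_integrand]) measurable
  have S_eq: "S = (\<lambda>b. \<integral>t. g' t * cnj (\<phi>' (t - b)) \<partial>lborel)"
    unfolding S_def by (rule ext, rule integral_lebesgue_cong_AE[OF _ transform_integrand]) measurable
  have "conv_exists f g x \<longleftrightarrow> integrable lborel (\<lambda>u. f' u * g' (x - u))" for x
    unfolding conv_exists_def by (rule integrable_lebesgue_cong_AE[OF _ conv_integrand]) measurable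
  then show "AE x in lebesgue. conv_exists f g x"
    using AE_completion[OF AE_integrable_conv_lborel[OF f' g']] by simp
  have "integrable lebesgue (\<lambda>t. g t * cnj (\<phi> (t - b))) \<longleftrightarrow>
      integrable lborel (\<lambda>t. g' t * cnj (\<phi>' (t - b)))"
    by (rule integrable_lebesgue_cong_AE[OF _ transform_integrand]) measurable
  then show "integrable lebesgue (\<lambda>t. g t * cnj (\<phi> (t - b)))"
    using integrable_mult_L2_lborel[OF g'(1) \<phi>'(1) g'(2) \<phi>'(2)] by simp
  \<comment> \<open>Since \<open>conv f g\<close> and \<open>S\<close> already coincide everywhere
    with their Borel versions, only \<phi> on the left side and only \<open>f\<close> on the right
    side remain to be replaced.\<close>
  have left_eq: "AE t in lborel. conv f g t * cnj (\<phi> (t - b)) = conv f g t * cnj (\<phi>' (t - b))"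
    using \<phi>_shift[of b] by eventually_elim simp
  have left: "integrable lborel (\<lambda>t. conv f g t * cnj (\<phi>' (t - b)))"
    unfolding conv_eq by (rule integrable_transform_conv_lborel[OF f' g' \<phi>'])
  note left_meas = borel_measurable_integrable[OF left, simplified]
  have right_eq: "AE u in lborel. f u * S (b - u) = f' u * S (b - u)"
    using ff' by eventually_elim simp
  have right: "integrable lborel (\<lambda>u. f' u * S (b - u))"
    unfolding S_eq by (rule integrable_conv_transform_lborel[OF f' g' \<phi>'])
  note right_meas = borel_measurable_integrable[OF right, simplified]
  show "integrable lebesgue (\<lambda>t. conv f g t * cnj (\<phi> (t - b)))"
    using left integrable_lebesgue_cong_AE[OF left_meas left_eq] by simp
  show "conv_exists f S b"
    using right integrable_lebesgue_cong_AE[OF right_meas right_eq] by (simp add: conv_exists_def)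
  have "(\<integral>t. conv f g t * cnj (\<phi> (t - b)) \<partial>lebesgue) = (\<integral>t. conv f g t * cnj (\<phi>' (t - b)) \<partial>lborel)"
    by (rule integral_lebesgue_cong_AE[OF left_meas left_eq])
  also have "\<dots> = (\<integral>u. f' u * S (b - u) \<partial>lborel)"
    unfolding conv_eq S_eq by (rule transform_conv_lborel[OF f' g' \<phi>'])
  also have "\<dots> = conv f S b"
    unfolding conv_def by (rule integral_lebesgue_cong_AE[OF right_meas right_eq, symmetric])
  finally show "(\<integral>t. conv f g t * cnj (\<phi> (t - b)) \<partial>lebesgue) = conv f S b" .
qed

section \<open>Correlation and wavelet atoms\<close>

text \<open>Substitute \<open>-u\<close> for \<open>u\<close>. Reflection preserves integrability
  and hence also the default value 0, so no hypothesis on \<open>f\<close> or \<open>g\<close> is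
  required.\<close>

lemma corr_eq_conv: "corr f g = conv (\<lambda>u. cnj (f (- u))) g"
proof
  fix x
  show "corr f g x = conv (\<lambda>u. cnj (f (- u))) g x"
    using lebesgue_integral_real_affine[of "-1" "\<lambda>u. cnj (f u) * g (x + u)" 0]
    by (simp add: corr_def conv_def)
qed

lemma corr_exists_eq_conv_exists: "corr_exists f g = conv_exists (\<lambda>u. cnj (f (- u))) g"
proof
  fix x
  show "corr_exists f g x = conv_exists (\<lambda>u. cnj (f (- u))) g x"
    using lebesgue_integrable_real_affine_iff[of "-1" "\<lambda>u. cnj (f u) * g (x + u)" 0]
    by (simp add: corr_exists_def conv_exists_def)
qed

lemma L1_cnj_reflect:
  assumes "f \<in> L1"
  shows "(\<lambda>u. cnj (f (- u))) \<in> L1"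
  using assms lebesgue_integrable_real_affine_iff[of "-1" f 0] by (simp add: L1_def)

lemma L2_scale:
  assumes "\<psi> \<in> L2" and "k \<noteq> 0"
  shows "(\<lambda>s. c * \<psi> (s / k)) \<in> L2"
proof -
  have "(\<lambda>s. \<psi> (s / k)) \<in> borel_measurable lebesgue"
    using borel_measurable_affine[of \<psi> "1 / k" 0] assms by (simp add: L2_def)
  moreover have "integrable lebesgue (\<lambda>s. (cmod (\<psi> (s / k)))\<^sup>2)"
    using lebesgue_integrable_real_affine[of "\<lambda>s. (cmod (\<psi> s))\<^sup>2" "1 / k" 0] assms
    by (simp add: L2_def)
  ultimately show ?thesis
    by (simp add: L2_def norm_mult power_mult_distrib)
qed

text \<open>At fixed scale all atoms are translates of the one at \<open>b = 0\<close>; this puts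
  the transform into the form of \<open>S\<close> with \<phi> =
  \<open>wavelet_atom \<theta> \<psi> a 0\<close>.\<close>

lemma wavelet_atom_translate: "wavelet_atom \<theta> \<psi> a b t = wavelet_atom \<theta> \<psi> a 0 (t - b)"
  by (simp add: wavelet_atom_def)

lemma wavelet_atom_L2:
  assumes "\<psi> \<in> L2" and "a \<noteq> 0"
  shows "wavelet_atom \<theta> \<psi> a 0 \<in> L2"
  using L2_scale[OF assms(1), of "sgn a * \<bar>a\<bar> powr (1 / \<theta>)"
      "complex_of_real (1 / \<bar>a\<bar> powr (1 / (2 * \<theta>)))"] assms(2)
  by (simp add: wavelet_atom_def[abs_def] sgn_zero_iff)

text \<open>The general identity with the atom at \<open>b = 0\<close> as \<phi>. It is stated for
  arbitrary \<open>f\<close> in \<open>L1\<close> so that the reflected conjugate can be inserted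
  for correlations.\<close>

lemma cfrwt_conv:
  assumes "f \<in> L1" "g \<in> L2" "\<psi> \<in> L2" "a \<noteq> 0"
  shows "AE x in lebesgue. conv_exists f g x" (is ?ae)
    and "cfrwt_exists \<theta> \<psi> g b a" (is ?ex)
    and "cfrwt_exists \<theta> \<psi> (conv f g) b a" (is ?left)
    and "conv_exists f (\<lambda>b'. cfrwt \<theta> \<psi> g b' a) b" (is ?right)
    and "cfrwt \<theta> \<psi> (conv f g) b a = conv f (\<lambda>b'. cfrwt \<theta> \<psi> g b' a) b" (is ?eq)
proof -
  note L2 = assms(1,2) wavelet_atom_L2[OF assms(3,4), of \<theta>]
  note atom = wavelet_atom_translate[of \<theta> \<psi> a]
  show ?ae by (rule AE_conv_exists[OF L2])
  show ?ex
    unfolding cfrwt_exists_def by (subst atom) (rule integrable_mult_L2[OF L2])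
  show ?left
    unfolding cfrwt_exists_def by (subst atom) (rule integrable_transform_conv[OF L2])
  show ?right
    unfolding cfrwt_def by (subst atom) (rule conv_exists_transform[OF L2])
  show ?eq
    unfolding cfrwt_def by (subst (1 2) atom) (rule transform_conv[OF L2])
qed

theorem theorem3p5:
  fixes \<theta> :: real and f g \<psi> :: "real \<Rightarrow> complex"
  assumes "0 < \<theta>" and "\<theta> \<le> 1"
    and "f \<in> L1" and "g \<in> L2" and "fractional_wavelet \<theta> \<psi>"
  shows "\<forall>a b. a \<noteq> 0 \<longrightarrow>
      ((AE x in lebesgue. conv_exists f g x) \<and>
       (\<forall>b'. cfrwt_exists \<theta> \<psi> g b' a) \<and>
       cfrwt_exists \<theta> \<psi> (conv f g) b a \<and>
       conv_exists f (\<lambda>b'. cfrwt \<theta> \<psi> g b' a) b \<and>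
       cfrwt \<theta> \<psi> (conv f g) b a = conv f (\<lambda>b'. cfrwt \<theta> \<psi> g b' a) b) \<and>
      ((AE x in lebesgue. corr_exists f g x) \<and>
       cfrwt_exists \<theta> \<psi> (corr f g) b a \<and>
       corr_exists f (\<lambda>b'. cfrwt \<theta> \<psi> g b' a) b \<and>
       cfrwt \<theta> \<psi> (corr f g) b a = corr f (\<lambda>b'. cfrwt \<theta> \<psi> g b' a) b)"
proof -
  have \<psi>: "\<psi> \<in> L2"
    using assms(5) by (simp add: fractional_wavelet_def)
  show ?thesis
    \<comment> \<open>The correlation half becomes the convolution half for
      \<open>cnj (f (- u))\<close>, which again lies in \<open>L1\<close>.\<close>
    unfolding corr_eq_conv corr_exists_eq_conv_exists
    by (intro allI impI conjI cfrwt_conv[OF assms(3,4) \<psi>]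
        cfrwt_conv[OF L1_cnj_reflect[OF assms(3)] assms(4) \<psi>])
qed

end
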